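(* Let $b,\sigma^1,\ldots,\sigma^m:\mathbb{R}^d\to\mathbb{R}^d$ have continuous first-order partial derivatives, with $b(0)=0$, and suppose there is a constant $K\ge 0$ such that $\|\sigma^k(x)\|\le K\|x\|$ for all $x\in\mathbb{R}^d$ and $k=1,\ldots,m$. Assume that $$-\lambda:=\sup_{x\neq 0}\left(\frac{\langle x,b(x)\rangle+\frac12\sum_{k=1}^m\|\sigma^k(x)\|^2}{\|x\|^2}-\frac{\sum_{k=1}^m\langle x,\sigma^k(x)\rangle^2}{\|x\|^4}\right)<0 .$$ Consider the direction and norm decomposition scheme $\bar X_n=\bar\eta_n\hat Z_n$ (defined in the context), with $\bar\eta_0>0$, and suppose that there exists $\gamma\ge0$ such that $$\mathbb{E}\exp\left(s\,\hat W^1_1\right)\le\exp\left(\gamma s^2\right)\qquad\forall s\in\mathbb{R}.$$ Then for every $\epsilon\in\,]0,\lambda[$ there exists $q\in\,]0,1[$ such that for all $p\in\,]0,q[$ and all step-sizes $\Delta>0$, $$\mathbb{E}\left(\|\bar X_n\|^p\right)\le\exp\left(-(\lambda-\epsilon)\,p\,n\,\Delta\right)\mathbb{E}\left(\|\bar X_0\|^p\right)\qquad\forall n\in\mathbb{N}.$$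
   Context: $\|\cdot\|$ and $\langle\cdot,\cdot\rangle$ are the Euclidean norm and scalar product on $\mathbb{R}^d$; $Jg$ is the Jacobian matrix of $g$. Direction and norm decomposition scheme (for $b(0)=\sigma^1(0)=\cdots=\sigma^m(0)=0$). For $\eta\in\mathbb{R}$, $z\in\mathbb{R}^d$ put $\bar b(\eta,z)=b(\eta z)/\eta$ if $\eta\ne0$, $\bar b(0,z)=Jb(0)z$; $\bar\sigma^k(\eta,z)=\sigma^k(\eta z)/\eta$ if $\eta\neq 0$, $\bar\sigma^k(0,z)=J\sigma^k(0)z$; and $$\Psi(\eta,z)=\sum_{k=1}^m\left(\left(\tfrac32\langle z,\bar\sigma^k(\eta,z)\rangle^2-\tfrac12\|\bar\sigma^k(\eta,z)\|^2\right)z-\langle z,\bar\sigma^k(\eta,z)\rangle\bar\sigma^k(\eta,z)\right).$$ Let $\bar\eta_0\in\mathbb{R}$ and $\hat Z_0\in\mathbb{R}^d$ be random variables with $\bar\eta_0\ge0$ and $\|\hat Z_0\|=1$. Let $\hat W^1_1,\ldots,\hat W^m_1,\hat W^1_2,\ldots$ be i.i.d. real random variables with symmetric law and variance $1$, independent of $(\bar\eta_0,\hat Z_0)$. For $\Delta>0$ define recursively $$\bar\eta_{n+1}=\bar\eta_n\exp\left(\mu_n\Delta+\sum_{k=1}^m\langle\hat Z_n,\bar\sigma^k(\bar\eta_n,\hat Z_n)\rangle\sqrt\Delta\,\hat W^k_{n+1}\right),$$ $$\mu_n=\langle\hat Z_n,\bar b(\bar\eta_n,\hat Z_n)\rangle+\tfrac12\sum_{k=1}^m\|\bar\sigma^k(\bar\eta_n,\hat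 Z_n)\|^2-\sum_{k=1}^m\langle\hat Z_n,\bar\sigma^k(\bar\eta_n,\hat Z_n)\rangle^2,$$ $$\bar Z_{n+1}=\hat Z_n+\left(\bar b(\bar\eta_n,\hat Z_n)-\langle\hat Z_n,\bar b(\bar\eta_n,\hat Z_n)\rangle\hat Z_n+\Psi(\bar\eta_n,\hat Z_n)\right)\Delta+\sum_{k=1}^m\left(\bar\sigma^k(\bar\eta_n,\hat Z_n)-\langle\hat Z_n,\bar\sigma^k(\bar\eta_n,\hat Z_n)\rangle\hat Z_n\right)\sqrt\Delta\,\hat W^k_{n+1},$$ and $\hat Z_{n+1}=\bar Z_{n+1}/\|\bar Z_{n+1}\|$ if $\bar Z_{n+1}\ne0$, $\hat Z_{n+1}=\hat Z_n$ if $\bar Z_{n+1}=0$. Finally $\bar X_n:=\bar\eta_n\hat Z_n$. The law of the $\hat W^k_n$ and of $(\bar\eta_0,\hat Z_0)$ do not depend on $\Delta$. *)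

theory Defs
  imports "HOL-Analysis.Analysis" "HOL-Probability.Probability"
begin

definition continuous_partials :: "(real ^ 'd \<Rightarrow> real ^ 'd) \<Rightarrow> bool" where
  "continuous_partials g \<longleftrightarrow>
    (\<forall>i j. \<exists>g'. continuous_on UNIV g' \<and>
      (\<forall>x. ((\<lambda>t. g (x + t *\<^sub>R axis j 1) $ i) has_real_derivative g' x) (at 0)))"

definition dir_coeff :: "(real ^ 'd \<Rightarrow> real ^ 'd) \<Rightarrow> real \<Rightarrow> real ^ 'd \<Rightarrow> real ^ 'd" where
  "dir_coeff g \<eta> z =
    (if \<eta> \<noteq> 0 then g (\<eta> *\<^sub>R z) /\<^sub>R \<eta> else jacobian g (at 0) *v z)"

definition Psi ::
  "nat \<Rightarrow> (nat \<Rightarrow> real ^ 'd \<Rightarrow> real ^ 'd) \<Rightarrow> real \<Rightarrow> real ^ 'd \<Rightarrow> real ^ 'd" where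
  "Psi m \<sigma> \<eta> z =
    (\<Sum>k = 1..m. (3/2 * (z \<bullet> dir_coeff (\<sigma> k) \<eta> z)\<^sup>2 - 1/2 * (norm (dir_coeff (\<sigma> k) \<eta> z))\<^sup>2) *\<^sub>R z
                  - (z \<bullet> dir_coeff (\<sigma> k) \<eta> z) *\<^sub>R dir_coeff (\<sigma> k) \<eta> z)"

definition log_norm_drift ::
  "nat \<Rightarrow> (real ^ 'd \<Rightarrow> real ^ 'd) \<Rightarrow> (nat \<Rightarrow> real ^ 'd \<Rightarrow> real ^ 'd)
    \<Rightarrow> real \<Rightarrow> real ^ 'd \<Rightarrow> real" where
  "log_norm_drift m b \<sigma> \<eta> z =
    z \<bullet> dir_coeff b \<eta> z + 1/2 * (\<Sum>k = 1..m. (norm (dir_coeff (\<sigma> k) \<eta> z))\<^sup>2)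
      - (\<Sum>k = 1..m. (z \<bullet> dir_coeff (\<sigma> k) \<eta> z)\<^sup>2)"

text \<open>
  In the next three functions \<open>w k\<close> is the increment driving the \<open>k\<close>-th noise in the step
  and \<open>\<Delta>\<close> is the step-size.
\<close>

definition norm_step ::
  "nat \<Rightarrow> (real ^ 'd \<Rightarrow> real ^ 'd) \<Rightarrow> (nat \<Rightarrow> real ^ 'd \<Rightarrow> real ^ 'd) \<Rightarrow> real
    \<Rightarrow> (nat \<Rightarrow> real) \<Rightarrow> real \<Rightarrow> real ^ 'd \<Rightarrow> real" where
  "norm_step m b \<sigma> \<Delta> w \<eta> z =
    \<eta> * exp (log_norm_drift m b \<sigma> \<eta> z * \<Delta>
             + (\<Sum>k = 1..m. (z \<bullet> dir_coeff (\<sigma> k) \<eta> z) * sqrt \<Delta> * w k))"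

definition pre_direction_step ::
  "nat \<Rightarrow> (real ^ 'd \<Rightarrow> real ^ 'd) \<Rightarrow> (nat \<Rightarrow> real ^ 'd \<Rightarrow> real ^ 'd) \<Rightarrow> real
    \<Rightarrow> (nat \<Rightarrow> real) \<Rightarrow> real \<Rightarrow> real ^ 'd \<Rightarrow> real ^ 'd" where
  "pre_direction_step m b \<sigma> \<Delta> w \<eta> z =
    z + \<Delta> *\<^sub>R (dir_coeff b \<eta> z - (z \<bullet> dir_coeff b \<eta> z) *\<^sub>R z + Psi m \<sigma> \<eta> z)
      + (\<Sum>k = 1..m. (sqrt \<Delta> * w k) *\<^sub>R
           (dir_coeff (\<sigma> k) \<eta> z - (z \<bullet> dir_coeff (\<sigma> k) \<eta> z) *\<^sub>R z))"

definition direction_step ::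
  "nat \<Rightarrow> (real ^ 'd \<Rightarrow> real ^ 'd) \<Rightarrow> (nat \<Rightarrow> real ^ 'd \<Rightarrow> real ^ 'd) \<Rightarrow> real
    \<Rightarrow> (nat \<Rightarrow> real) \<Rightarrow> real \<Rightarrow> real ^ 'd \<Rightarrow> real ^ 'd" where
  "direction_step m b \<sigma> \<Delta> w \<eta> z =
    (let z' = pre_direction_step m b \<sigma> \<Delta> w \<eta> z
     in if z' \<noteq> 0 then z' /\<^sub>R norm z' else z)"

text \<open>
  The pair \<open>(\<eta>\<^sub>n, Z\<^sub>n)\<close> along one path; \<open>w k n\<close> is the value of the \<open>k\<close>-th noise at time \<open>n\<close>,
  used from \<open>n = 1\<close> on.
\<close>

primrec norm_direction ::
  "nat \<Rightarrow> (real ^ 'd \<Rightarrow> real ^ 'd) \<Rightarrow> (nat \<Rightarrow> real ^ 'd \<Rightarrow> real ^ 'd) \<Rightarrow> real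
    \<Rightarrow> (nat \<Rightarrow> nat \<Rightarrow> real) \<Rightarrow> real \<Rightarrow> real ^ 'd \<Rightarrow> nat \<Rightarrow> real \<times> (real ^ 'd)" where
  "norm_direction m b \<sigma> \<Delta> w \<eta>0 z0 0 = (\<eta>0, z0)"
| "norm_direction m b \<sigma> \<Delta> w \<eta>0 z0 (Suc n) =
    (let (\<eta>, z) = norm_direction m b \<sigma> \<Delta> w \<eta>0 z0 n
     in (norm_step m b \<sigma> \<Delta> (\<lambda>k. w k (Suc n)) \<eta> z,
         direction_step m b \<sigma> \<Delta> (\<lambda>k. w k (Suc n)) \<eta> z))"

definition dn_scheme ::
  "nat \<Rightarrow> (real ^ 'd \<Rightarrow> real ^ 'd) \<Rightarrow> (nat \<Rightarrow> real ^ 'd \<Rightarrow> real ^ 'd) \<Rightarrow> real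
    \<Rightarrow> (nat \<Rightarrow> nat \<Rightarrow> 'w \<Rightarrow> real) \<Rightarrow> ('w \<Rightarrow> real) \<Rightarrow> ('w \<Rightarrow> real ^ 'd)
    \<Rightarrow> nat \<Rightarrow> 'w \<Rightarrow> real ^ 'd" where
  "dn_scheme m b \<sigma> \<Delta> W \<eta>0 Z0 n \<omega> =
    (let (\<eta>, z) = norm_direction m b \<sigma> \<Delta> (\<lambda>k n. W k n \<omega>) (\<eta>0 \<omega>) (Z0 \<omega>) n in \<eta> *\<^sub>R z)"

text \<open>
  The library's \<open>indep_var\<close> forces both random variables to have the same value type, so
  independence of \<open>X\<close> and \<open>Y\<close> is stated here through the \<open>\<sigma>\<close>-algebras they generate.
\<close>

definition indep_rv ::
  "'w measure \<Rightarrow> 'a measure \<Rightarrow> ('w \<Rightarrow> 'a) \<Rightarrow> 'b measure \<Rightarrow> ('w \<Rightarrow> 'b) \<Rightarrow> bool" where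
  "indep_rv M N X N' Y \<longleftrightarrow> X \<in> measurable M N \<and> Y \<in> measurable M N' \<and>
    prob_space.indep_set M {X -` A \<inter> space M |A. A \<in> sets N} {Y -` A \<inter> space M |A. A \<in> sets N'}"

text \<open>
  The noise \<open>W k n\<close> (\<open>1 \<le> k \<le> m\<close>, \<open>n \<ge> 1\<close>) is i.i.d. with symmetric law and variance 1, and the
  whole family is independent of the pair \<open>(\<eta>0, Z0)\<close>. If \<open>W k n\<close> had no finite second moment,
  the Bochner integral defining the variance would be 0, so variance 1 entails square-integrability.
\<close>

definition scheme_noise ::
  "'w measure \<Rightarrow> nat \<Rightarrow> (nat \<Rightarrow> nat \<Rightarrow> 'w \<Rightarrow> real) \<Rightarrow> ('w \<Rightarrow> real) \<Rightarrow> ('w \<Rightarrow> real ^ 'd) \<Rightarrow> bool" where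
  "scheme_noise M m W \<eta>0 Z0 \<longleftrightarrow>
    (let I = {1..m} \<times> {1..} in
      prob_space.indep_vars M (\<lambda>_. borel) (\<lambda>(k, n). W k n) I \<and>
      (\<forall>(k, n)\<in>I. \<forall>(k', n')\<in>I. distr M borel (W k n) = distr M borel (W k' n')) \<and>
      (\<forall>(k, n)\<in>I. distr M borel (\<lambda>\<omega>. - W k n \<omega>) = distr M borel (W k n)) \<and>
      (\<forall>(k, n)\<in>I. prob_space.variance M (W k n) = 1) \<and>
      indep_rv M borel (\<lambda>\<omega>. (\<eta>0 \<omega>, Z0 \<omega>))
        (Pi\<^sub>M I (\<lambda>_. borel)) (\<lambda>\<omega>. \<lambda>(k, n)\<in>I. W k n \<omega>))"

end

theory Submission
  imports Defs
begin

text \<open>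
  Almost surely \<open>\<eta>\<^sub>0 > 0\<close> and \<open>\<parallel>Z\<^sub>0\<parallel> = 1\<close>, and the scheme preserves both properties, so the norm
  of the scheme is \<open>\<eta>\<^sub>n\<close> and only the scalar recursion
  \<open>\<eta>\<^sub>n\<^sub>+\<^sub>1 = \<eta>\<^sub>n exp (\<mu>\<^sub>n \<Delta> + \<Sum>\<^sub>k c\<^sub>k \<surd>\<Delta> W\<^sub>k)\<close>, with \<open>c\<^sub>k = \<langle>Z\<^sub>n, \<sigma>\<^sub>k(\<eta>\<^sub>n Z\<^sub>n)\<rangle> / \<eta>\<^sub>n\<close>, has to be estimated.
  Put \<open>x = \<eta>\<^sub>n Z\<^sub>n \<noteq> 0\<close>. Then \<open>\<mu>\<^sub>n\<close> is exactly the expression in \<open>x\<close> whose supremum is \<open>-\<lambda>\<close>, so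
  \<open>\<mu>\<^sub>n \<le> -\<lambda>\<close> (\<open>log_norm_drift_le\<close>), and linear growth of the noise coefficients gives
  \<open>\<bar>c\<^sub>k\<bar> \<le> K\<close> (\<open>norm_dir_coeff_le\<close>).

  Conditionally on the first \<open>n\<close> steps the \<open>m\<close> new increments are independent and sub-Gaussian,
  hence
  \<open>E(\<eta>\<^sub>n\<^sub>+\<^sub>1\<^sup>p | past) \<le> \<eta>\<^sub>n\<^sup>p exp (-p \<lambda> \<Delta>) \<Prod>\<^sub>k exp (\<gamma> p\<^sup>2 c\<^sub>k\<^sup>2 \<Delta>) \<le> \<eta>\<^sub>n\<^sup>p exp (-(\<lambda> - m \<gamma> K\<^sup>2 p) p \<Delta>)\<close>
  (\<open>norm_step_moment\<close>). The sub-Gaussian correction to the exponent is quadratic in \<open>p\<close> and, like the decay,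
  linear in \<open>\<Delta>\<close>; therefore \<open>p \<le> \<epsilon> / (m \<gamma> K\<^sup>2 + 1)\<close> makes it at most \<open>\<epsilon> p \<Delta>\<close> for every step-size at once.
  Iterating over \<open>n\<close> yields the theorem.

  The conditional expectation is carried out by moving to a product space: by independence, the
  initial state and the noise up to time \<open>n\<close> have a product law, so the initial state can be frozen
  (\<open>nn_integral_indep_rv\<close>), and Fubini separates the last time step from the earlier ones
  (\<open>norm_direction_moment\<close>). This requires the scheme to be a Borel function of the initial state and
  the noise, which is where the regularity of the coefficients enters.
\<close>

section \<open>Continuity from continuous partial derivatives\<close>

text \<open>
  Near a point \<open>x\<close> all partial derivatives are bounded by one constant. Changing the coordinates of
  \<open>x\<close> into those of \<open>y\<close> one at a time and applying the mean value theorem to each change gives a local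
  Lipschitz bound; the intermediate points stay in every ball around \<open>x\<close> that contains \<open>y\<close>.
\<close>

lemma continuous_partials_imp_continuous:
  fixes g :: "real ^ 'd \<Rightarrow> real ^ 'd"
  assumes "continuous_partials g"
  shows "continuous_on UNIV g"
proof -
  have "isCont (\<lambda>x. g x $ i) x" for i x
  proof -
    define h where "h = (\<lambda>x. g x $ i)"
    have "\<forall>j. \<exists>g'. continuous_on UNIV g' \<and>
        (\<forall>x. ((\<lambda>t. h (x + t *\<^sub>R axis j 1)) has_real_derivative g' x) (at 0))"
      using assms unfolding continuous_partials_def h_def by blast
    then obtain D where D_cont: "\<And>j. continuous_on UNIV (D j)"
      and D: "\<And>j x. ((\<lambda>t. h (x + t *\<^sub>R axis j 1)) has_real_derivative D j x) (at 0)"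
      by metis
    have line: "((\<lambda>t. h (u + t *\<^sub>R axis j 1)) has_real_derivative D j (u + t *\<^sub>R axis j 1)) (at t)"
      for u j t
    proof -
      have "((\<lambda>s. h (u + (s + t) *\<^sub>R axis j 1)) has_real_derivative D j (u + t *\<^sub>R axis j 1)) (at 0)"
        using D[of "u + t *\<^sub>R axis j 1" j] by (simp add: algebra_simps)
      then show ?thesis
        using DERIV_shift[of "\<lambda>t. h (u + t *\<^sub>R axis j 1)" "D j (u + t *\<^sub>R axis j 1)" 0 t] by simp
    qed
    have "\<exists>B. \<forall>u\<in>cball x 1. norm (D j u) \<le> B" for j
    proof -
      have "compact (D j ` cball x 1)"
        by (intro compact_continuous_image continuous_on_subset[OF D_cont]) auto
      then show ?thesis
        by (meson bounded_iff compact_imp_bounded imageI)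
    qed
    then obtain B' where B': "\<And>j u. u \<in> cball x 1 \<Longrightarrow> norm (D j u) \<le> B' j"
      by metis
    \<comment> \<open>a sum instead of a maximum: it dominates every \<open>B' j\<close> and is obviously nonnegative\<close>
    define B where "B = (\<Sum>j\<in>UNIV. \<bar>B' j\<bar>)"
    have B: "norm (D j u) \<le> B" if "u \<in> cball x 1" for j u
    proof -
      have "\<bar>B' j\<bar> \<le> B"
        unfolding B_def by (rule member_le_sum) auto
      then show ?thesis
        using B'[OF that, of j] by linarith
    qed
    have B_nonneg: "B \<ge> 0"
      unfolding B_def by (simp add: sum_nonneg)
    have bound: "\<bar>h y - h x\<bar> \<le> real CARD('d) * B * norm (y - x)" if y: "y \<in> cball x 1" for y
    proof -
      \<comment> \<open>the hybrid point that has already taken over the coordinates in \<open>S\<close> from \<open>y\<close>\<close>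
      define Y where "Y S = (\<chi> j. if j \<in> S then y $ j else x $ j)" for S :: "'d set"
      have "\<bar>h (Y S) - h x\<bar> \<le> real (card S) * (B * norm (y - x))" if "finite S" for S
        using that
      proof (induction S rule: finite_induct)
        case empty
        have "Y {} = x" by (simp add: Y_def vec_eq_iff)
        then show ?case by simp
      next
        case (insert j S)
        define t where "t = y $ j - x $ j"
        have Y_ins: "Y (insert j S) = Y S + t *\<^sub>R axis j 1"
          using insert.hyps by (auto simp: Y_def vec_eq_iff t_def axis_def)
        have in_ball: "Y S + s *\<^sub>R axis j 1 \<in> cball x 1" if "s \<in> closed_segment 0 t" for s
        proof -
          have "\<bar>s\<bar> \<le> \<bar>t\<bar>"
            using that by (auto simp: closed_segment_eq_real_ivl split: if_splits)
          then have "norm (Y S + s *\<^sub>R axis j 1 - x) \<le> norm (y - x)"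
            using insert.hyps
            by (intro norm_le_componentwise_cart) (auto simp: Y_def t_def axis_def)
          then show ?thesis
            using y by (simp add: dist_norm norm_minus_commute)
        qed
        have "norm (h (Y S + t *\<^sub>R axis j 1) - h (Y S + 0 *\<^sub>R axis j 1)) \<le> B * norm (t - 0)"
        proof (rule field_differentiable_bound[where S = "closed_segment 0 t"])
          show "((\<lambda>s. h (Y S + s *\<^sub>R axis j 1)) has_field_derivative D j (Y S + s *\<^sub>R axis j 1))
              (at s within closed_segment 0 t)" for s
            using line by (rule has_field_derivative_at_within)
        qed (use B in_ball in auto)
        moreover have "B * norm t \<le> B * norm (y - x)"
          using component_le_norm_cart[of "y - x" j] B_nonneg
          by (intro mult_left_mono) (auto simp: t_def)
        ultimately have "\<bar>h (Y (insert j S)) - h (Y S)\<bar> \<le> B * norm (y - x)"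
          using Y_ins by simp
        then show ?case
          using insert by (simp add: algebra_simps)
      qed
      from this[of UNIV] show ?thesis
        by (simp add: Y_def mult.assoc)
    qed
    have "((\<lambda>y. h y - h x) \<longlongrightarrow> 0) (at x)"
    proof (rule Lim_null_comparison)
      have "eventually (\<lambda>y. y \<in> cball x 1) (at x)"
        using eventually_at_ball[of 1 x UNIV] by (auto elim: eventually_mono)
      then show "eventually (\<lambda>y. norm (h y - h x) \<le> real CARD('d) * B * norm (y - x)) (at x)"
        by eventually_elim (use bound in simp)
      show "((\<lambda>y. real CARD('d) * B * norm (y - x)) \<longlongrightarrow> 0) (at x)"
        by (auto intro!: tendsto_eq_intros)
    qed
    then show "isCont (\<lambda>x. g x $ i) x"
      unfolding isCont_def h_def using Lim_null by blast
  qed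
  then show ?thesis
    by (auto simp: continuous_on_eq_continuous_at isCont_def intro: vec_tendstoI)
qed

section \<open>Independence and product laws\<close>

lemma distr_indep_rv:
  assumes "prob_space M" and "indep_rv M N X N' Y"
  shows "distr M (N \<Otimes>\<^sub>M N') (\<lambda>\<omega>. (X \<omega>, Y \<omega>)) = distr M N X \<Otimes>\<^sub>M distr M N' Y"
proof -
  interpret prob_space M by fact
  have [measurable]: "X \<in> measurable M N" "Y \<in> measurable M N'"
    and indep: "indep_set {X -` A \<inter> space M |A. A \<in> sets N} {Y -` A \<inter> space M |A. A \<in> sets N'}"
    using assms(2) by (auto simp: indep_rv_def)
  interpret X: prob_space "distr M N X" by (rule prob_space_distr) simp
  interpret Y: prob_space "distr M N' Y" by (rule prob_space_distr) simp
  show ?thesis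
  proof (rule pair_measure_eqI[symmetric])
    show "sigma_finite_measure (distr M N X)" "sigma_finite_measure (distr M N' Y)"
      by unfold_locales
    fix A B
    assume "A \<in> sets (distr M N X)" "B \<in> sets (distr M N' Y)"
    then have [measurable]: "A \<in> sets N" "B \<in> sets N'" by auto
    have "(\<lambda>\<omega>. (X \<omega>, Y \<omega>)) -` (A \<times> B) \<inter> space M = (X -` A \<inter> space M) \<inter> (Y -` B \<inter> space M)"
      by auto
    moreover have "prob ((X -` A \<inter> space M) \<inter> (Y -` B \<inter> space M))
        = prob (X -` A \<inter> space M) * prob (Y -` B \<inter> space M)"
      by (rule indep_setD[OF indep]) auto
    ultimately show "emeasure (distr M N X) A * emeasure (distr M N' Y) B
        = emeasure (distr M (N \<Otimes>\<^sub>M N') (\<lambda>\<omega>. (X \<omega>, Y \<omega>))) (A \<times> B)"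
      by (simp add: emeasure_distr emeasure_eq_measure ennreal_mult'')
  qed simp
qed

text \<open>
  Freezing: the first variable is left on the original space, so that almost sure properties of it
  can be used there, and only the second is replaced by its law.
\<close>

lemma nn_integral_indep_rv:
  assumes "prob_space M" and indep: "indep_rv M N X N' Y"
    and [measurable]: "f \<in> borel_measurable (N \<Otimes>\<^sub>M N')"
  shows "(\<integral>\<^sup>+\<omega>. f (X \<omega>, Y \<omega>) \<partial>M) = (\<integral>\<^sup>+\<omega>. (\<integral>\<^sup>+y. f (X \<omega>, y) \<partial>distr M N' Y) \<partial>M)"
proof -
  interpret prob_space M by fact
  have [measurable]: "X \<in> measurable M N" "Y \<in> measurable M N'"
    using indep by (auto simp: indep_rv_def)
  interpret Y: prob_space "distr M N' Y" by (rule prob_space_distr) simp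
  have "(\<integral>\<^sup>+\<omega>. f (X \<omega>, Y \<omega>) \<partial>M)
      = (\<integral>\<^sup>+v. f v \<partial>(distr M N X \<Otimes>\<^sub>M distr M N' Y))"
    by (simp add: nn_integral_distr flip: distr_indep_rv[OF assms(1) indep])
  also have "\<dots> = (\<integral>\<^sup>+x. (\<integral>\<^sup>+y. f (x, y) \<partial>distr M N' Y) \<partial>distr M N X)"
    by (rule Y.nn_integral_fst[symmetric]) simp
  also have "\<dots> = (\<integral>\<^sup>+\<omega>. (\<integral>\<^sup>+y. f (X \<omega>, y) \<partial>distr M N' Y) \<partial>M)"
    by (subst nn_integral_distr) auto
  finally show ?thesis .
qed

text \<open>
  The index set may be empty: this occurs below when no noise is present or no step has been made.
\<close>

lemma (in prob_space) distr_indep_vars_finite: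
  assumes "finite J" and "indep_vars (\<lambda>_. N) X J"
    and "\<And>i. i \<in> J \<Longrightarrow> distr M N (X i) = L"
    and "sets L = sets N"
  shows "distr M (Pi\<^sub>M J (\<lambda>_. N)) (\<lambda>\<omega>. \<lambda>i\<in>J. X i \<omega>) = Pi\<^sub>M J (\<lambda>_. L)"
proof (cases "J = {}")
  case True
  show ?thesis
  proof (rule measure_eqI)
    fix A
    assume "A \<in> sets (distr M (Pi\<^sub>M J (\<lambda>_. N)) (\<lambda>\<omega>. \<lambda>i\<in>J. X i \<omega>))"
    then have "A = {} \<or> A = {\<lambda>_. undefined}"
      using True by (auto simp: PiM_empty)
    then show "emeasure (distr M (Pi\<^sub>M J (\<lambda>_. N)) (\<lambda>\<omega>. \<lambda>i\<in>J. X i \<omega>)) A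
        = emeasure (Pi\<^sub>M J (\<lambda>_. L)) A"
      using True by (auto simp: PiM_empty emeasure_distr emeasure_space_1 restrict_def)
  qed (use True in \<open>simp add: PiM_empty\<close>)
next
  case False
  have rv: "X i \<in> measurable M N" if "i \<in> J" for i
    using assms(2) that by (auto simp: indep_vars_def)
  have "distr M (Pi\<^sub>M J (\<lambda>_. N)) (\<lambda>\<omega>. \<lambda>i\<in>J. X i \<omega>) = Pi\<^sub>M J (\<lambda>i. distr M N (X i))"
    using assms(2) indep_vars_iff_distr_eq_PiM'[OF False rv, of "\<lambda>i. i"] by simp
  also have "\<dots> = Pi\<^sub>M J (\<lambda>_. L)"
    by (rule PiM_cong) (use assms(3) in auto)
  finally show ?thesis .
qed

section \<open>The scheme as a function of initial state and noise\<close>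

text \<open>
  At norm \<open>0\<close> the coefficient is the Jacobian at the origin applied to the direction, which is linear
  in the direction; so both branches are Borel, and they are glued along the Borel set \<open>{e = 0}\<close>.
\<close>

lemma measurable_dir_coeff:
  assumes "continuous_on UNIV g"
    and [measurable]: "e \<in> borel_measurable N" "z \<in> borel_measurable N"
  shows "(\<lambda>\<omega>. dir_coeff g (e \<omega>) (z \<omega>)) \<in> borel_measurable N"
proof -
  have [measurable]: "g \<in> borel_measurable borel"
    using assms(1) by (rule borel_measurable_continuous_onI)
  have "continuous_on UNIV (\<lambda>v. jacobian g (at 0) *v v)"
    by (rule linear_continuous_on) (rule matrix_vector_mul_bounded_linear)
  then have [measurable]: "(\<lambda>v. jacobian g (at 0) *v v) \<in> borel_measurable borel"
    by (rule borel_measurable_continuous_onI)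
  show ?thesis
    unfolding dir_coeff_def by measurable
qed

lemma measurable_norm_direction:
  assumes "continuous_on UNIV b" and "\<And>k. k \<in> {1..m} \<Longrightarrow> continuous_on UNIV (\<sigma> k)"
    and [measurable]: "e \<in> borel_measurable N" "z \<in> borel_measurable N"
    and w: "\<And>k j. k \<in> {1..m} \<Longrightarrow> j \<in> {1..n} \<Longrightarrow> w k j \<in> borel_measurable N"
  shows "(\<lambda>\<omega>. norm_direction m b \<sigma> \<Delta> (\<lambda>k j. w k j \<omega>) (e \<omega>) (z \<omega>) n) \<in> borel_measurable N"
  using w
proof (induction n)
  case 0
  show ?case by simp
next
  case (Suc n)
  define S where "S \<omega> = norm_direction m b \<sigma> \<Delta> (\<lambda>k j. w k j \<omega>) (e \<omega>) (z \<omega>) n" for \<omega>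
  have "S \<in> borel_measurable N"
    unfolding S_def using Suc by simp
  then have [measurable]: "(\<lambda>\<omega>. fst (S \<omega>)) \<in> borel_measurable N" "(\<lambda>\<omega>. snd (S \<omega>)) \<in> borel_measurable N"
    by (auto simp flip: borel_prod)
  have [measurable]: "(\<lambda>\<omega>. dir_coeff b (fst (S \<omega>)) (snd (S \<omega>))) \<in> borel_measurable N"
    using assms(1) by (rule measurable_dir_coeff) auto
  have coeff [measurable]: "(\<lambda>\<omega>. dir_coeff (\<sigma> k) (fst (S \<omega>)) (snd (S \<omega>))) \<in> borel_measurable N"
    if "k \<in> {1..m}" for k
    using assms(2)[OF that] by (rule measurable_dir_coeff) auto
  have noise [measurable]: "w k (Suc n) \<in> borel_measurable N" if "k \<in> {1..m}" for k
    using Suc.prems that by simp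
  have [measurable]: "(\<lambda>\<omega>. log_norm_drift m b \<sigma> (fst (S \<omega>)) (snd (S \<omega>))) \<in> borel_measurable N"
    unfolding log_norm_drift_def by measurable
  have "(\<lambda>\<omega>. norm_step m b \<sigma> \<Delta> (\<lambda>k. w k (Suc n) \<omega>) (fst (S \<omega>)) (snd (S \<omega>))) \<in> borel_measurable N"
    unfolding norm_step_def by measurable
  moreover have [measurable]: "(\<lambda>\<omega>. Psi m \<sigma> (fst (S \<omega>)) (snd (S \<omega>))) \<in> borel_measurable N"
    unfolding Psi_def by measurable
  have [measurable]: "(\<lambda>\<omega>. pre_direction_step m b \<sigma> \<Delta> (\<lambda>k. w k (Suc n) \<omega>) (fst (S \<omega>)) (snd (S \<omega>)))
      \<in> borel_measurable N"
    unfolding pre_direction_step_def by measurable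
  have "(\<lambda>\<omega>. direction_step m b \<sigma> \<Delta> (\<lambda>k. w k (Suc n) \<omega>) (fst (S \<omega>)) (snd (S \<omega>)))
      \<in> borel_measurable N"
    unfolding direction_step_def Let_def by measurable
  ultimately show ?case
    by (simp add: S_def case_prod_beta Let_def flip: borel_prod)
qed

lemma norm_direction_cong:
  assumes "\<And>k j. k \<in> {1..m} \<Longrightarrow> j \<in> {1..n} \<Longrightarrow> w k j = w' k j"
  shows "norm_direction m b \<sigma> \<Delta> w e z n = norm_direction m b \<sigma> \<Delta> w' e z n"
  using assms
proof (induction n)
  case (Suc n)
  have "norm_direction m b \<sigma> \<Delta> w e z n = norm_direction m b \<sigma> \<Delta> w' e z n"
    using Suc by simp
  moreover have "w k (Suc n) = w' k (Suc n)" if "k \<in> {1..m}" for k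
    using Suc.prems that by simp
  ultimately show ?case
    by (simp add: norm_step_def direction_step_def pre_direction_step_def case_prod_beta)
qed simp

text \<open>
  The direction stays a unit vector even when the unnormalised step vanishes, because the
  previous direction is then kept.
\<close>

lemma norm_direction_state:
  assumes "e > 0" "norm z = 1"
  shows "fst (norm_direction m b \<sigma> \<Delta> w e z n) > 0"
    and "norm (snd (norm_direction m b \<sigma> \<Delta> w e z n)) = 1"
  using assms
  by (induction n) (auto simp: case_prod_beta Let_def norm_step_def direction_step_def)

lemma norm_dn_scheme:
  assumes "\<eta>0 \<omega> > 0" "norm (Z0 \<omega>) = 1"
  shows "norm (dn_scheme m b \<sigma> \<Delta> W \<eta>0 Z0 n \<omega>)
    = fst (norm_direction m b \<sigma> \<Delta> (\<lambda>k n. W k n \<omega>) (\<eta>0 \<omega>) (Z0 \<omega>) n)"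
  using norm_direction_state[OF assms] by (simp add: dn_scheme_def case_prod_beta Let_def less_imp_le)

section \<open>Bounds on the coefficients\<close>

text \<open>
  The drift of the logarithm of the norm depends only on the point \<open>x = e z\<close>: each factor \<open>1 / e\<close> in
  a directional coefficient is a factor \<open>1 / \<parallel>x\<parallel>\<close>, which turns the drift into the bounded expression.
\<close>

lemma log_norm_drift_le:
  assumes "\<And>x. x \<noteq> 0 \<Longrightarrow>
      (x \<bullet> b x + 1/2 * (\<Sum>k = 1..m. (norm (\<sigma> k x))\<^sup>2)) / (norm x)^2
        - (\<Sum>k = 1..m. (x \<bullet> \<sigma> k x)\<^sup>2) / (norm x)^4 \<le> - lam"
    and "e > 0" "norm z = 1"
  shows "log_norm_drift m b \<sigma> e z \<le> - lam"
proof -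
  let ?x = "e *\<^sub>R z"
  have "(?x \<bullet> b ?x + 1/2 * (\<Sum>k = 1..m. (norm (\<sigma> k ?x))\<^sup>2)) / (norm ?x)^2
        - (\<Sum>k = 1..m. (?x \<bullet> \<sigma> k ?x)\<^sup>2) / (norm ?x)^4 = log_norm_drift m b \<sigma> e z"
  proof -
    have "(\<Sum>k = 1..m. (norm (dir_coeff (\<sigma> k) e z))\<^sup>2) = (\<Sum>k = 1..m. (norm (\<sigma> k ?x))\<^sup>2) / e^2"
      using assms(2) by (simp add: dir_coeff_def sum_divide_distrib power_mult_distrib divide_simps)
    moreover have "(\<Sum>k = 1..m. (z \<bullet> dir_coeff (\<sigma> k) e z)\<^sup>2) = (\<Sum>k = 1..m. (?x \<bullet> \<sigma> k ?x)\<^sup>2) / e^4"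
      unfolding sum_divide_distrib
      by (rule sum.cong) (use assms(2) in \<open>auto simp: dir_coeff_def power_mult_distrib field_simps eval_nat_numeral\<close>)
    moreover have "z \<bullet> dir_coeff b e z = ?x \<bullet> b ?x / e^2"
      using assms(2) by (simp add: dir_coeff_def field_simps power2_eq_square)
    ultimately show ?thesis
      using assms(2,3) by (simp add: log_norm_drift_def add_divide_distrib)
  qed
  moreover have "?x \<noteq> 0" using assms(2,3) by auto
  ultimately show ?thesis
    using assms(1)[of ?x] by simp
qed

lemma norm_dir_coeff_le:
  assumes "\<And>x. norm (g x) \<le> K * norm x" "e > 0" "norm z = 1"
  shows "norm (dir_coeff g e z) \<le> K"
  using assms(1)[of "e *\<^sub>R z"] assms(2,3) by (simp add: dir_coeff_def field_simps)

section \<open>Moments of the norm component\<close>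

text \<open>
  The \<open>p\<close>-th power of the step is a constant times a product of exponentials in the separate
  coordinates of the noise, so its integral against a product measure is a product of moment
  generating functions at \<open>p c\<^sub>k \<surd>\<Delta>\<close>, where \<open>c\<^sub>k = \<langle>z, \<sigma>\<^sub>k(e z)\<rangle> / e\<close> satisfies \<open>\<bar>c\<^sub>k\<bar> \<le> K\<close>.
\<close>

lemma norm_step_moment:
  assumes L: "prob_space L" "sets L = sets borel"
    and mgf: "\<And>s. (\<integral>\<^sup>+x. ennreal (exp (s * x)) \<partial>L) \<le> ennreal (exp (\<gamma> * s\<^sup>2))"
    and "\<gamma> \<ge> 0" "\<Delta> > 0" "p \<ge> 0" "e > 0" "norm z = 1"
    and drift: "log_norm_drift m b \<sigma> e z \<le> - lam"
    and diffusion: "\<And>k. k \<in> {1..m} \<Longrightarrow> norm (dir_coeff (\<sigma> k) e z) \<le> K"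
  shows "(\<integral>\<^sup>+y. ennreal (norm_step m b \<sigma> \<Delta> (\<lambda>k. y (k, N)) e z powr p) \<partial>Pi\<^sub>M ({1..m} \<times> {N :: nat}) (\<lambda>_. L))
    \<le> ennreal (exp (- (lam - real m * \<gamma> * K\<^sup>2 * p) * p * \<Delta>)) * ennreal (e powr p)"
proof -
  interpret L: prob_space L by fact
  interpret product_sigma_finite "\<lambda>_::nat \<times> nat. L" by unfold_locales
  have [measurable_cong]: "sets L = sets borel" by fact
  let ?I = "{1..m} \<times> {N}"
  define \<mu> where "\<mu> = log_norm_drift m b \<sigma> e z"
  define c where "c k = p * ((z \<bullet> dir_coeff (\<sigma> k) e z) * sqrt \<Delta>)" for k
  have step: "norm_step m b \<sigma> \<Delta> (\<lambda>k. y (k, N)) e z powr p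
      = e powr p * exp (p * \<mu> * \<Delta>) * (\<Prod>i\<in>?I. exp (c (fst i) * y i))" for y :: "nat \<times> nat \<Rightarrow> real"
  proof -
    have "(\<Prod>i\<in>?I. exp (c (fst i) * y i)) = exp (\<Sum>k = 1..m. c k * y (k, N))"
      using prod.cartesian_product[of "\<lambda>k n. exp (c k * y (k, n))" "{N}" "{1..m}"]
      by (simp add: exp_sum case_prod_beta')
    moreover have "(\<Sum>k = 1..m. c k * y (k, N))
        = p * (\<Sum>k = 1..m. (z \<bullet> dir_coeff (\<sigma> k) e z) * sqrt \<Delta> * y (k, N))"
      by (simp add: c_def sum_distrib_left mult_ac)
    moreover have "norm_step m b \<sigma> \<Delta> (\<lambda>k. y (k, N)) e z powr p
        = e powr p * exp (p * \<mu> * \<Delta> + p * (\<Sum>k = 1..m. (z \<bullet> dir_coeff (\<sigma> k) e z) * sqrt \<Delta> * y (k, N)))"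
      using \<open>e > 0\<close> unfolding norm_step_def \<mu>_def
      by (subst powr_mult) (simp_all add: exp_powr_real ring_distribs mult_ac)
    ultimately show ?thesis
      by (simp only: exp_add mult.assoc)
  qed
  have c: "(\<integral>\<^sup>+x. ennreal (exp (c k * x)) \<partial>L) \<le> ennreal (exp (\<gamma> * (p\<^sup>2 * K\<^sup>2 * \<Delta>)))" if "k \<in> {1..m}" for k
  proof -
    have "\<bar>z \<bullet> dir_coeff (\<sigma> k) e z\<bar> \<le> K"
      using Cauchy_Schwarz_ineq2[of z "dir_coeff (\<sigma> k) e z"] diffusion[OF that] \<open>norm z = 1\<close> by simp
    then have "(z \<bullet> dir_coeff (\<sigma> k) e z)\<^sup>2 \<le> K\<^sup>2"
      by (metis abs_ge_zero power2_abs power_mono)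
    then have "p\<^sup>2 * (z \<bullet> dir_coeff (\<sigma> k) e z)\<^sup>2 * \<Delta> \<le> p\<^sup>2 * K\<^sup>2 * \<Delta>"
      using \<open>\<Delta> > 0\<close> by (intro mult_right_mono mult_left_mono) auto
    then have "(c k)\<^sup>2 \<le> p\<^sup>2 * K\<^sup>2 * \<Delta>"
      using \<open>\<Delta> > 0\<close> by (simp add: c_def power_mult_distrib mult.assoc)
    then have "exp (\<gamma> * (c k)\<^sup>2) \<le> exp (\<gamma> * (p\<^sup>2 * K\<^sup>2 * \<Delta>))"
      using \<open>\<gamma> \<ge> 0\<close> by (simp add: mult_left_mono)
    then show ?thesis
      using mgf[of "c k"] by (meson ennreal_leI order_trans)
  qed
  have noise: "(\<Prod>i\<in>?I. \<integral>\<^sup>+x. ennreal (exp (c (fst i) * x)) \<partial>L)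
      \<le> ennreal (exp (real m * (\<gamma> * (p\<^sup>2 * K\<^sup>2 * \<Delta>))))"
  proof -
    have "(\<Prod>i\<in>?I. \<integral>\<^sup>+x. ennreal (exp (c (fst i) * x)) \<partial>L)
        \<le> (\<Prod>i\<in>?I. ennreal (exp (\<gamma> * (p\<^sup>2 * K\<^sup>2 * \<Delta>))))"
      by (rule prod_mono_ennreal) (use c in auto)
    also have "\<dots> = ennreal (exp (real m * (\<gamma> * (p\<^sup>2 * K\<^sup>2 * \<Delta>))))"
      by (simp add: ennreal_power exp_of_nat_mult card_cartesian_product)
    finally show ?thesis .
  qed
  have "p * \<mu> * \<Delta> \<le> p * - lam * \<Delta>"
    unfolding \<mu>_def using drift \<open>\<Delta> > 0\<close> \<open>p \<ge> 0\<close> by (intro mult_right_mono mult_left_mono) auto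
  then have decay: "ennreal (e powr p * exp (p * \<mu> * \<Delta>)) \<le> ennreal (e powr p * exp (p * - lam * \<Delta>))"
    by (intro ennreal_leI mult_left_mono) auto
  have "(\<integral>\<^sup>+y. ennreal (norm_step m b \<sigma> \<Delta> (\<lambda>k. y (k, N)) e z powr p) \<partial>Pi\<^sub>M ?I (\<lambda>_. L))
      = (\<integral>\<^sup>+y. ennreal (e powr p * exp (p * \<mu> * \<Delta>)) * (\<Prod>i\<in>?I. ennreal (exp (c (fst i) * y i))) \<partial>Pi\<^sub>M ?I (\<lambda>_. L))"
    unfolding step by (rule nn_integral_cong) (simp add: prod_ennreal flip: ennreal_mult')
  also have "\<dots> = ennreal (e powr p * exp (p * \<mu> * \<Delta>)) * (\<integral>\<^sup>+y. (\<Prod>i\<in>?I. ennreal (exp (c (fst i) * y i))) \<partial>Pi\<^sub>M ?I (\<lambda>_. L))"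
    by (rule nn_integral_cmult) measurable
  also have "(\<integral>\<^sup>+y. (\<Prod>i\<in>?I. ennreal (exp (c (fst i) * y i))) \<partial>Pi\<^sub>M ?I (\<lambda>_. L))
      = (\<Prod>i\<in>?I. \<integral>\<^sup>+x. ennreal (exp (c (fst i) * x)) \<partial>L)"
    by (rule product_nn_integral_prod) auto
  also have "ennreal (e powr p * exp (p * \<mu> * \<Delta>)) * \<dots>
      \<le> ennreal (e powr p * exp (p * - lam * \<Delta>)) * ennreal (exp (real m * (\<gamma> * (p\<^sup>2 * K\<^sup>2 * \<Delta>))))"
    using decay noise by (rule mult_mono) auto
  also have "\<dots> = ennreal (exp (- (lam - real m * \<gamma> * K\<^sup>2 * p) * p * \<Delta>)) * ennreal (e powr p)"
  proof -
    have "exp (p * - lam * \<Delta>) * exp (real m * (\<gamma> * (p\<^sup>2 * K\<^sup>2 * \<Delta>)))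
        = exp (- (lam - real m * \<gamma> * K\<^sup>2 * p) * p * \<Delta>)"
      unfolding exp_add[symmetric] by (simp add: algebra_simps power2_eq_square)
    then have "(e powr p * exp (p * - lam * \<Delta>)) * exp (real m * (\<gamma> * (p\<^sup>2 * K\<^sup>2 * \<Delta>)))
        = exp (- (lam - real m * \<gamma> * K\<^sup>2 * p) * p * \<Delta>) * e powr p"
      by (simp only: mult.assoc mult.commute)
    then show ?thesis
      by (metis ennreal_mult' ennreal_mult'' exp_ge_zero)
  qed
  finally show ?thesis .
qed

text \<open>
  Induction on the number of steps. The product measure over the first \<open>n + 1\<close> times splits into the
  first \<open>n\<close> times and the last one; integrating over the last one first, with the state after \<open>n\<close>
  steps fixed, contracts the moment by the factor of a single step.
\<close>

lemma norm_direction_moment: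
  assumes b: "continuous_on UNIV b" and \<sigma>: "\<And>k. k \<in> {1..m} \<Longrightarrow> continuous_on UNIV (\<sigma> k)"
    and L: "prob_space L" "sets L = sets borel"
    and mgf: "\<And>s. (\<integral>\<^sup>+x. ennreal (exp (s * x)) \<partial>L) \<le> ennreal (exp (\<gamma> * s\<^sup>2))"
    and pos: "\<gamma> \<ge> 0" "\<Delta> > 0" "p \<ge> 0"
    and drift: "\<And>e z. e > 0 \<Longrightarrow> norm z = 1 \<Longrightarrow> log_norm_drift m b \<sigma> e z \<le> - lam"
    and diffusion: "\<And>k e z. k \<in> {1..m} \<Longrightarrow> e > 0 \<Longrightarrow> norm z = 1 \<Longrightarrow> norm (dir_coeff (\<sigma> k) e z) \<le> K"
    and init: "e > 0" "norm z = 1"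
  shows "(\<integral>\<^sup>+w. ennreal (fst (norm_direction m b \<sigma> \<Delta> (\<lambda>k j. w (k, j)) e z n) powr p)
      \<partial>Pi\<^sub>M ({1..m} \<times> {1..n}) (\<lambda>_. L))
    \<le> ennreal (exp (- (lam - real m * \<gamma> * K\<^sup>2 * p) * p * real n * \<Delta>)) * ennreal (e powr p)"
proof (induction n)
  case 0
  interpret L: prob_space L by fact
  interpret product_sigma_finite "\<lambda>_::nat \<times> nat. L" by unfold_locales
  show ?case
    by (simp add: PiM_empty nn_integral_count_space_finite)
next
  case (Suc n)
  interpret L: prob_space L by fact
  interpret product_sigma_finite "\<lambda>_::nat \<times> nat. L" by unfold_locales
  have [measurable_cong]: "sets L = sets borel" by fact
  let ?I = "{1..m} \<times> {1..n}" and ?J = "{1..m} \<times> {Suc n}"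
  let ?S = "\<lambda>w. norm_direction m b \<sigma> \<Delta> (\<lambda>k j. w (k, j)) e z"
  define r where "r = exp (- (lam - real m * \<gamma> * K\<^sup>2 * p) * p * \<Delta>)"
  have meas: "(\<lambda>w. ?S w N) \<in> borel_measurable (Pi\<^sub>M ({1..m} \<times> {1..N}) (\<lambda>_. L))" for N
    by (rule measurable_norm_direction) (use b \<sigma> in \<open>auto\<close>)
  have meas_p: "(\<lambda>w. ennreal (fst (?S w N) powr p)) \<in> borel_measurable (Pi\<^sub>M ({1..m} \<times> {1..N}) (\<lambda>_. L))" for N
  proof -
    have [measurable]: "(\<lambda>w. fst (?S w N)) \<in> borel_measurable (Pi\<^sub>M ({1..m} \<times> {1..N}) (\<lambda>_. L))"
      using meas[of N] by (auto simp flip: borel_prod)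
    show ?thesis by measurable
  qed
  have split: "{1..m} \<times> {1..Suc n} = ?I \<union> ?J"
    by auto
  have "(\<integral>\<^sup>+w. ennreal (fst (?S w (Suc n)) powr p) \<partial>Pi\<^sub>M ({1..m} \<times> {1..Suc n}) (\<lambda>_. L))
      = (\<integral>\<^sup>+x. (\<integral>\<^sup>+y. ennreal (fst (?S (merge ?I ?J (x, y)) (Suc n)) powr p) \<partial>Pi\<^sub>M ?J (\<lambda>_. L))
          \<partial>Pi\<^sub>M ?I (\<lambda>_. L))"
    unfolding split by (rule product_nn_integral_fold) (use meas_p[of "Suc n"] split in auto)
  also have "\<dots> \<le> (\<integral>\<^sup>+x. ennreal r * ennreal (fst (?S x n) powr p) \<partial>Pi\<^sub>M ?I (\<lambda>_. L))"
  proof (rule nn_integral_mono)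
    fix x :: "nat \<times> nat \<Rightarrow> real"
    have "fst (?S (merge ?I ?J (x, y)) (Suc n))
        = norm_step m b \<sigma> \<Delta> (\<lambda>k. y (k, Suc n)) (fst (?S x n)) (snd (?S x n))" for y
    proof -
      have "?S (merge ?I ?J (x, y)) n = ?S x n"
        by (rule norm_direction_cong) (auto simp: merge_def)
      then show ?thesis
        by (simp add: case_prod_beta Let_def norm_step_def merge_def)
    qed
    then show "(\<integral>\<^sup>+y. ennreal (fst (?S (merge ?I ?J (x, y)) (Suc n)) powr p) \<partial>Pi\<^sub>M ?J (\<lambda>_. L))
        \<le> ennreal r * ennreal (fst (?S x n) powr p)"
      unfolding r_def
      using norm_step_moment[OF L mgf pos norm_direction_state[OF init]
          drift[OF norm_direction_state[OF init]] diffusion[OF _ norm_direction_state[OF init]]]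
      by simp
  qed
  also have "\<dots> = ennreal r * (\<integral>\<^sup>+x. ennreal (fst (?S x n) powr p) \<partial>Pi\<^sub>M ?I (\<lambda>_. L))"
    by (rule nn_integral_cmult) (rule meas_p)
  also have "\<dots> \<le> ennreal r *
      (ennreal (exp (- (lam - real m * \<gamma> * K\<^sup>2 * p) * p * real n * \<Delta>)) * ennreal (e powr p))"
    by (rule mult_left_mono[OF Suc.IH]) simp
  also have "\<dots> = ennreal (exp (- (lam - real m * \<gamma> * K\<^sup>2 * p) * p * real (Suc n) * \<Delta>)) * ennreal (e powr p)"
  proof -
    have "r * exp (- (lam - real m * \<gamma> * K\<^sup>2 * p) * p * real n * \<Delta>)
        = exp (- (lam - real m * \<gamma> * K\<^sup>2 * p) * p * real (Suc n) * \<Delta>)"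
      unfolding r_def exp_add[symmetric] by (simp add: algebra_simps)
    then show ?thesis
      unfolding mult.assoc[symmetric] by (metis ennreal_mult'' exp_ge_zero)
  qed
  finally show ?case .
qed

section \<open>The law of the noise\<close>

text \<open>
  Only \<open>W 1 1\<close> carries the sub-Gaussian bound; equality in law spreads it to the whole family. For
  \<open>m = 0\<close> the family is empty and \<open>W 1 1\<close> need not even be measurable, so the point mass at \<open>0\<close> is
  taken instead.
\<close>

lemma scheme_noise_common_law:
  assumes "prob_space M" "scheme_noise M m W \<eta>0 Z0"
    and "\<gamma> \<ge> 0"
    and "\<And>s::real. (\<integral>\<^sup>+\<omega>. ennreal (exp (s * W 1 1 \<omega>)) \<partial>M) \<le> ennreal (exp (\<gamma> * s\<^sup>2))"
  obtains L :: "real measure" where "prob_space L" "sets L = sets borel"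
    "\<And>s. (\<integral>\<^sup>+x. ennreal (exp (s * x)) \<partial>L) \<le> ennreal (exp (\<gamma> * s\<^sup>2))"
    "\<And>k n. k \<in> {1..m} \<Longrightarrow> n \<ge> 1 \<Longrightarrow> distr M borel (W k n) = L"
proof (cases "m = 0")
  case True
  show ?thesis
  proof (rule that[of "return borel 0"])
    show "(\<integral>\<^sup>+x. ennreal (exp (s * x)) \<partial>return borel 0) \<le> ennreal (exp (\<gamma> * s\<^sup>2))" for s
      using \<open>\<gamma> \<ge> 0\<close> by (simp add: nn_integral_return)
  qed (use True in \<open>auto intro: prob_space_return\<close>)
next
  case False
  interpret prob_space M by fact
  have "indep_vars (\<lambda>_. borel) (case_prod W) ({1..m} \<times> {1..})"
    using assms(2) unfolding scheme_noise_def Let_def by simp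
  then have "case_prod W i \<in> borel_measurable M" if "i \<in> {1..m} \<times> {1..}" for i
    using that unfolding indep_vars_def by blast
  moreover have "(1, 1) \<in> {1..m} \<times> {1::nat..}"
    using False by simp
  ultimately have "case_prod W (1, 1) \<in> borel_measurable M"
    by blast
  then have W11: "W 1 1 \<in> borel_measurable M"
    by (simp only: case_prod_conv)
  show ?thesis
  proof (rule that[of "distr M borel (W 1 1)"])
    show "prob_space (distr M borel (W 1 1))"
      using W11 by (rule prob_space_distr)
    show "(\<integral>\<^sup>+x. ennreal (exp (s * x)) \<partial>distr M borel (W 1 1)) \<le> ennreal (exp (\<gamma> * s\<^sup>2))" for s
    proof -
      have "(\<integral>\<^sup>+x. ennreal (exp (s * x)) \<partial>distr M borel (W 1 1)) = (\<integral>\<^sup>+\<omega>. ennreal (exp (s * W 1 1 \<omega>)) \<partial>M)"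
        by (rule nn_integral_distr[OF W11]) measurable
      then show ?thesis
        using assms(4) by (simp only:)
    qed
    show "distr M borel (W k n) = distr M borel (W 1 1)" if "k \<in> {1..m}" "n \<ge> 1" for k n
    proof -
      have "\<forall>(k, n)\<in>{1..m} \<times> {1..}. \<forall>(k', n')\<in>{1..m} \<times> {1..}.
          distr M borel (W k n) = distr M borel (W k' n')"
        using assms(2) unfolding scheme_noise_def Let_def by (elim conjE)
      moreover have "(k, n) \<in> {1..m} \<times> {1..}" "(1, 1) \<in> {1..m} \<times> {1::nat..}"
        using that False by simp_all
      ultimately show ?thesis
        by blast
    qed
  qed simp
qed

text \<open>
  The noise up to time \<open>n\<close> is a measurable function of the whole noise, so it generates a smaller
  \<open>\<sigma>\<close>-algebra and inherits the independence of the initial state.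
\<close>

lemma indep_rv_scheme_noise:
  assumes "prob_space M" "scheme_noise M m W \<eta>0 Z0"
  shows "indep_rv M borel (\<lambda>\<omega>. (\<eta>0 \<omega>, Z0 \<omega>)) (Pi\<^sub>M ({1..m} \<times> {1..n}) (\<lambda>_. borel))
    (\<lambda>\<omega>. \<lambda>i\<in>{1..m} \<times> {1..n}. case_prod W i \<omega>)"
proof -
  interpret prob_space M by fact
  let ?I = "{1..m} \<times> {1::nat..}" and ?J = "{1..m} \<times> {1..n}"
  let ?X = "\<lambda>\<omega>. (\<eta>0 \<omega>, Z0 \<omega>)"
  let ?Y = "\<lambda>\<omega>. \<lambda>i\<in>?I. case_prod W i \<omega>" and ?Y' = "\<lambda>\<omega>. \<lambda>i\<in>?J. case_prod W i \<omega>"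
  have indep: "indep_rv M borel ?X (Pi\<^sub>M ?I (\<lambda>_. borel)) ?Y"
    using assms(2) unfolding scheme_noise_def Let_def
    by (simp add: case_prod_beta' cong: restrict_cong)
  have Y': "?Y' \<omega> = restrict (?Y \<omega>) ?J" for \<omega>
    by (auto simp: restrict_def fun_eq_iff)
  have res [measurable]: "(\<lambda>f. restrict f ?J) \<in> measurable (Pi\<^sub>M ?I (\<lambda>_. borel)) (Pi\<^sub>M ?J (\<lambda>_. borel :: real measure))"
    by (rule measurable_restrict_subset) auto
  have [measurable]: "?Y \<in> measurable M (Pi\<^sub>M ?I (\<lambda>_. borel))"
    using indep unfolding indep_rv_def by simp
  have Y'_meas: "?Y' \<in> measurable M (Pi\<^sub>M ?J (\<lambda>_. borel))"
    unfolding Y' by measurable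
  have sub: "{?Y' -` A \<inter> space M |A. A \<in> sets (Pi\<^sub>M ?J (\<lambda>_. borel))}
      \<subseteq> {?Y -` A \<inter> space M |A. A \<in> sets (Pi\<^sub>M ?I (\<lambda>_. borel))}"
  proof safe
    fix A assume A: "A \<in> sets (Pi\<^sub>M ?J (\<lambda>_. borel :: real measure))"
    define B where "B = (\<lambda>f. restrict f ?J) -` A \<inter> space (Pi\<^sub>M ?I (\<lambda>_. borel :: real measure))"
    have "B \<in> sets (Pi\<^sub>M ?I (\<lambda>_. borel))"
      unfolding B_def by (rule measurable_sets[OF res A])
    moreover have "?Y' -` A \<inter> space M = ?Y -` B \<inter> space M"
      unfolding B_def Y' by (auto simp: space_PiM)
    ultimately show "\<exists>B. ?Y' -` A \<inter> space M = ?Y -` B \<inter> space M \<and> B \<in> sets (Pi\<^sub>M ?I (\<lambda>_. borel))"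
      by blast
  qed
  moreover have "indep_set {?X -` A \<inter> space M |A. A \<in> sets borel}
      {?Y' -` A \<inter> space M |A. A \<in> sets (Pi\<^sub>M ?J (\<lambda>_. borel))}"
  proof -
    have "indep_set {?X -` A \<inter> space M |A. A \<in> sets borel}
        {?Y -` A \<inter> space M |A. A \<in> sets (Pi\<^sub>M ?I (\<lambda>_. borel))}"
      using indep by (simp only: indep_rv_def)
    then show ?thesis
      unfolding indep_set_def
      by (rule indep_sets_mono_sets) (use sub in \<open>simp split: bool.split\<close>)
  qed
  ultimately show ?thesis
    using indep Y'_meas by (simp only: indep_rv_def)
qed

section \<open>Exponential decay of moments\<close>

theorem theorem3p2:
  fixes M :: "'w measure"
    and m :: nat
    and b :: "real ^ 'd \<Rightarrow> real ^ 'd"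
    and \<sigma> :: "nat \<Rightarrow> real ^ 'd \<Rightarrow> real ^ 'd"
    and W :: "nat \<Rightarrow> nat \<Rightarrow> 'w \<Rightarrow> real"
    and \<eta>0 :: "'w \<Rightarrow> real"
    and Z0 :: "'w \<Rightarrow> real ^ 'd"
    and K lam \<gamma> :: real
  assumes "continuous_partials b"
    and "\<And>k. k \<in> {1..m} \<Longrightarrow> continuous_partials (\<sigma> k)"
    and "b 0 = 0"
    and "K \<ge> 0"
    and "\<And>k x. k \<in> {1..m} \<Longrightarrow> norm (\<sigma> k x) \<le> K * norm x"
    and "ereal (- lam) =
      (SUP x\<in>{x. x \<noteq> 0}. ereal (
          (x \<bullet> b x + 1/2 * (\<Sum>k = 1..m. (norm (\<sigma> k x))\<^sup>2)) / (norm x)^2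
          - (\<Sum>k = 1..m. (x \<bullet> \<sigma> k x)\<^sup>2) / (norm x)^4))"
    and "- lam < 0"
    and "prob_space M"
    and "scheme_noise M m W \<eta>0 Z0"
    and "AE \<omega> in M. \<eta>0 \<omega> > 0"
    and "AE \<omega> in M. norm (Z0 \<omega>) = 1"
    and "\<gamma> \<ge> 0"
    and "\<And>s::real. (\<integral>\<^sup>+\<omega>. ennreal (exp (s * W 1 1 \<omega>)) \<partial>M) \<le> ennreal (exp (\<gamma> * s\<^sup>2))"
  shows "\<forall>\<epsilon>\<in>{0<..<lam}. \<exists>q\<in>{0<..<1}. \<forall>p\<in>{0<..<q}. \<forall>\<Delta>>0. \<forall>n::nat.
    (\<integral>\<^sup>+\<omega>. ennreal (norm (dn_scheme m b \<sigma> \<Delta> W \<eta>0 Z0 n \<omega>) powr p) \<partial>M)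
      \<le> ennreal (exp (- (lam - \<epsilon>) * p * real n * \<Delta>))
        * (\<integral>\<^sup>+\<omega>. ennreal (norm (dn_scheme m b \<sigma> \<Delta> W \<eta>0 Z0 0 \<omega>) powr p) \<partial>M)"
proof
  fix \<epsilon> assume \<epsilon>: "\<epsilon> \<in> {0<..<lam}"
  interpret prob_space M by fact
  have b: "continuous_on UNIV b"
    using assms(1) by (rule continuous_partials_imp_continuous)
  have \<sigma>: "continuous_on UNIV (\<sigma> k)" if "k \<in> {1..m}" for k
    using assms(2)[OF that] by (rule continuous_partials_imp_continuous)
  have drift: "log_norm_drift m b \<sigma> e z \<le> - lam" if "e > 0" "norm z = 1" for e z
  proof (rule log_norm_drift_le[OF _ that])
    fix x :: "real ^ 'd"
    let ?f = "\<lambda>x. (x \<bullet> b x + 1/2 * (\<Sum>k = 1..m. (norm (\<sigma> k x))\<^sup>2)) / (norm x)^2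
        - (\<Sum>k = 1..m. (x \<bullet> \<sigma> k x)\<^sup>2) / (norm x)^4"
    assume "x \<noteq> 0"
    then have "ereal (?f x) \<le> (SUP x\<in>{x. x \<noteq> 0}. ereal (?f x))"
      by (intro SUP_upper) simp
    then show "?f x \<le> - lam"
      unfolding assms(6)[symmetric] by simp
  qed
  have diffusion: "norm (dir_coeff (\<sigma> k) e z) \<le> K" if "k \<in> {1..m}" "e > 0" "norm z = 1" for k e z
    using assms(5)[OF that(1)] that(2,3) by (rule norm_dir_coeff_le)
  obtain L :: "real measure" where L: "prob_space L" "sets L = sets borel"
    "\<And>s. (\<integral>\<^sup>+x. ennreal (exp (s * x)) \<partial>L) \<le> ennreal (exp (\<gamma> * s\<^sup>2))"
    and law: "\<And>k n. k \<in> {1..m} \<Longrightarrow> n \<ge> 1 \<Longrightarrow> distr M borel (W k n) = L"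
    using scheme_noise_common_law[OF assms(8,9,12,13)] by blast
  define C where "C = real m * \<gamma> * K\<^sup>2"
  have C: "C \<ge> 0"
    using assms(12) by (simp add: C_def)
  \<comment> \<open>\<open>1/2\<close> keeps \<open>q\<close> below \<open>1\<close>; the \<open>+ 1\<close> makes the quotient meaningful when \<open>C = 0\<close>\<close>
  define q where "q = min (1/2) (\<epsilon> / (C + 1))"
  have "q \<in> {0<..<1}"
    using \<epsilon> C by (auto simp: q_def)
  moreover have "(\<integral>\<^sup>+\<omega>. ennreal (norm (dn_scheme m b \<sigma> \<Delta> W \<eta>0 Z0 n \<omega>) powr p) \<partial>M)
      \<le> ennreal (exp (- (lam - \<epsilon>) * p * real n * \<Delta>))
        * (\<integral>\<^sup>+\<omega>. ennreal (norm (dn_scheme m b \<sigma> \<Delta> W \<eta>0 Z0 0 \<omega>) powr p) \<partial>M)"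
    if p: "p \<in> {0<..<q}" and \<Delta>: "\<Delta> > 0" for p \<Delta> n
  proof -
    have "p * (C + 1) \<le> \<epsilon>"
      using p C by (simp add: q_def pos_less_divide_eq)
    then have "C * p \<le> \<epsilon>"
      using p by (simp add: algebra_simps)
    let ?J = "{1..m} \<times> {1..n}"
    let ?X = "\<lambda>\<omega>. (\<eta>0 \<omega>, Z0 \<omega>)" and ?Y = "\<lambda>\<omega>. \<lambda>i\<in>?J. case_prod W i \<omega>"
    define S where "S = (\<lambda>((e, z), w). norm_direction m b \<sigma> \<Delta> (\<lambda>k j. w (k, j)) e z n)"
    have indep: "indep_rv M borel ?X (Pi\<^sub>M ?J (\<lambda>_. borel)) ?Y"
      by (rule indep_rv_scheme_noise) fact+
    have X: "?X \<in> borel_measurable M"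
      using indep by (simp add: indep_rv_def)
    have [measurable]: "\<eta>0 \<in> borel_measurable M" "Z0 \<in> borel_measurable M"
      using measurable_compose[OF X[folded borel_prod] measurable_fst]
        measurable_compose[OF X[folded borel_prod] measurable_snd] by auto
    have "S \<in> borel_measurable ((borel \<Otimes>\<^sub>M borel) \<Otimes>\<^sub>M Pi\<^sub>M ?J (\<lambda>_. borel))"
      unfolding S_def case_prod_beta
      by (rule measurable_norm_direction) (use b \<sigma> in auto)
    then have [measurable]: "(\<lambda>v. fst (S v)) \<in> borel_measurable (borel \<Otimes>\<^sub>M Pi\<^sub>M ?J (\<lambda>_. borel))"
      by (auto simp flip: borel_prod)
    have noise_law: "distr M (Pi\<^sub>M ?J (\<lambda>_. borel)) ?Y = Pi\<^sub>M ?J (\<lambda>_. L)"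
    proof (rule distr_indep_vars_finite)
      have "indep_vars (\<lambda>_. borel) (case_prod W) ({1..m} \<times> {1..})"
        using assms(9) unfolding scheme_noise_def Let_def by simp
      then show "indep_vars (\<lambda>_. borel) (case_prod W) ?J"
        by (rule indep_vars_subset) auto
    qed (use law L in auto)
    have "(\<integral>\<^sup>+\<omega>. ennreal (norm (dn_scheme m b \<sigma> \<Delta> W \<eta>0 Z0 n \<omega>) powr p) \<partial>M)
        = (\<integral>\<^sup>+\<omega>. ennreal (fst (S (?X \<omega>, ?Y \<omega>)) powr p) \<partial>M)"
    proof (rule nn_integral_cong_AE)
      show "AE \<omega> in M. ennreal (norm (dn_scheme m b \<sigma> \<Delta> W \<eta>0 Z0 n \<omega>) powr p)
          = ennreal (fst (S (?X \<omega>, ?Y \<omega>)) powr p)"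
        using assms(10,11)
      proof eventually_elim
        case (elim \<omega>)
        have "norm_direction m b \<sigma> \<Delta> (\<lambda>k j. W k j \<omega>) (\<eta>0 \<omega>) (Z0 \<omega>) n
            = norm_direction m b \<sigma> \<Delta> (\<lambda>k j. ?Y \<omega> (k, j)) (\<eta>0 \<omega>) (Z0 \<omega>) n"
          by (rule norm_direction_cong) simp
        then show ?case
          using norm_dn_scheme[of \<eta>0 \<omega> Z0, OF elim] by (simp add: S_def)
      qed
    qed
    also have "\<dots> = (\<integral>\<^sup>+\<omega>. (\<integral>\<^sup>+w. ennreal (fst (S (?X \<omega>, w)) powr p) \<partial>Pi\<^sub>M ?J (\<lambda>_. L)) \<partial>M)"
    proof -
      have "(\<lambda>v. ennreal (fst (S v) powr p)) \<in> borel_measurable (borel \<Otimes>\<^sub>M Pi\<^sub>M ?J (\<lambda>_. borel))"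
        by measurable
      from nn_integral_indep_rv[OF assms(8) indep this] show ?thesis
        unfolding noise_law .
    qed
    also have "\<dots> \<le> (\<integral>\<^sup>+\<omega>. ennreal (exp (- (lam - \<epsilon>) * p * real n * \<Delta>)) *
        ennreal (norm (dn_scheme m b \<sigma> \<Delta> W \<eta>0 Z0 0 \<omega>) powr p) \<partial>M)"
    proof (rule nn_integral_mono_AE)
      show "AE \<omega> in M. (\<integral>\<^sup>+w. ennreal (fst (S (?X \<omega>, w)) powr p) \<partial>Pi\<^sub>M ?J (\<lambda>_. L))
          \<le> ennreal (exp (- (lam - \<epsilon>) * p * real n * \<Delta>)) *
            ennreal (norm (dn_scheme m b \<sigma> \<Delta> W \<eta>0 Z0 0 \<omega>) powr p)"
        using assms(10,11)
      proof eventually_elim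
        case (elim \<omega>)
        have "p \<ge> 0" using p by simp
        have "(\<integral>\<^sup>+w. ennreal (fst (S (?X \<omega>, w)) powr p) \<partial>Pi\<^sub>M ?J (\<lambda>_. L))
            \<le> ennreal (exp (- (lam - C * p) * p * real n * \<Delta>)) * ennreal (\<eta>0 \<omega> powr p)"
          using norm_direction_moment[OF b \<sigma> L assms(12) \<Delta> \<open>p \<ge> 0\<close> drift diffusion elim]
          by (simp add: S_def C_def)
        also have "\<dots> \<le> ennreal (exp (- (lam - \<epsilon>) * p * real n * \<Delta>)) * ennreal (\<eta>0 \<omega> powr p)"
          using \<open>C * p \<le> \<epsilon>\<close> \<Delta> \<open>p \<ge> 0\<close>
          by (intro mult_right_mono ennreal_leI) (auto intro!: mult_right_mono)
        finally show ?case
          using norm_dn_scheme[of \<eta>0 \<omega> Z0 m b \<sigma> \<Delta> W 0, OF elim] by simp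
      qed
    qed
    also have "\<dots> = ennreal (exp (- (lam - \<epsilon>) * p * real n * \<Delta>))
        * (\<integral>\<^sup>+\<omega>. ennreal (norm (dn_scheme m b \<sigma> \<Delta> W \<eta>0 Z0 0 \<omega>) powr p) \<partial>M)"
      by (rule nn_integral_cmult) (simp add: dn_scheme_def)
    finally show ?thesis .
  qed
  ultimately show "\<exists>q\<in>{0<..<1}. \<forall>p\<in>{0<..<q}. \<forall>\<Delta>>0. \<forall>n::nat.
    (\<integral>\<^sup>+\<omega>. ennreal (norm (dn_scheme m b \<sigma> \<Delta> W \<eta>0 Z0 n \<omega>) powr p) \<partial>M)
      \<le> ennreal (exp (- (lam - \<epsilon>) * p * real n * \<Delta>))
        * (\<integral>\<^sup>+\<omega>. ennreal (norm (dn_scheme m b \<sigma> \<Delta> W \<eta>0 Z0 0 \<omega>) powr p) \<partial>M)"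
    by blast
qed

end
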